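(* If $\theta$ is a $C^0$ flow on a locally compact, connected metric space $M$ with only countably many compact minimal sets and displaying no orbits of infinite height, then the set $\mathfrak A(M)$ of all compact minimal sets of the flow that are either attractors, or repellers, or isolated from minimals and stagnant, is $d_H$-open and $d_H$-dense in $\mathrm{CMin}(M)$.
   Context: A $C^0$ flow is a continuous action $\theta:\mathbb R\times M\to M$ of $(\mathbb R,+)$. A set is invariant if it is a union of orbits $\mathcal O(x)$; $\mathcal O^{\pm}(V)$ is the union of the positive/negative half orbits of points of $V$; $\omega(x),\alpha(x)$ are the usual limit sets (possibly empty). A neighbourhood of a set is a set whose interior contains it. A minimal set is a nonvoid, closed, invariant set containing no proper subset with these properties; $\mathrm{CMin}(M)$ is the set of compact minimal sets, endowed with the Hausdorff metric $d_H$ (the prefix $d_H$- refers to it). For a nonvoid compact invariant $X$: $B^{+}(X)=\{x:\emptyset\ne\omega(x)\subset X\}$, $B^{-}(X)=\{x:\emptyset\ne\alpha(x)\subset X\}$. $X$ is stable (negatively stable) if every neighbourhood $U$ of $X$ contains $\mathcal O^+(V)$ (resp. $\mathcal O^-(V)$) for some neighbourhood $V$ of $X$; an attractor if stable with $B^+(X)$ a neighbourhood of $X$; a repeller if negatively stable with $B^-(X)$ a neighbourhood of $X$; stagnant if there are $x,y\in M\setminus X$ with $\emptyset\ne\alpha(x)\subset X$ and $\emptyset\neq\omega(y)\subset X$; isolated from minimals if for some neighbourhood $U$ of $X$, $U\setminus X$ contains no minimal set. An orbit $\gamma_0$ is of infinite height if there are orbits $\gamma_1,\gamma_2,\ldots$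 with $\mathrm{cl}\,\gamma_0\supsetneq\mathrm{cl}\,\gamma_1\supsetneq\cdots\supsetneq\mathrm{cl}\,\gamma_n\supsetneq\cdots$. *)

theory Defs
  imports "HOL-Analysis.Analysis"
begin

text \<open>The phase space is the whole type \<open>'a\<close>.\<close>

definition C0_flow :: "(real \<Rightarrow> 'a::metric_space \<Rightarrow> 'a) \<Rightarrow> bool" where
  "C0_flow \<theta> \<longleftrightarrow>
     continuous_on UNIV (\<lambda>(t, x). \<theta> t x) \<and>
     (\<forall>x. \<theta> 0 x = x) \<and>
     (\<forall>s t x. \<theta> (s + t) x = \<theta> s (\<theta> t x))"

definition orbit :: "(real \<Rightarrow> 'a \<Rightarrow> 'a) \<Rightarrow> 'a \<Rightarrow> 'a set" where
  "orbit \<theta> x = range (\<lambda>t. \<theta> t x)"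

definition pos_orbits :: "(real \<Rightarrow> 'a \<Rightarrow> 'a) \<Rightarrow> 'a set \<Rightarrow> 'a set" where
  "pos_orbits \<theta> V = (\<Union>x\<in>V. (\<lambda>t. \<theta> t x) ` {0..})"

definition neg_orbits :: "(real \<Rightarrow> 'a \<Rightarrow> 'a) \<Rightarrow> 'a set \<Rightarrow> 'a set" where
  "neg_orbits \<theta> V = (\<Union>x\<in>V. (\<lambda>t. \<theta> t x) ` {..0})"

definition invariant :: "(real \<Rightarrow> 'a \<Rightarrow> 'a) \<Rightarrow> 'a set \<Rightarrow> bool" where
  "invariant \<theta> X \<longleftrightarrow> (\<exists>S. X = (\<Union>x\<in>S. orbit \<theta> x))"

definition omega_limit :: "(real \<Rightarrow> 'a::metric_space \<Rightarrow> 'a) \<Rightarrow> 'a \<Rightarrow> 'a set" where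
  "omega_limit \<theta> x =
     {y. \<exists>t. filterlim t at_top sequentially \<and> (\<lambda>n. \<theta> (t n) x) \<longlonglongrightarrow> y}"

definition alpha_limit :: "(real \<Rightarrow> 'a::metric_space \<Rightarrow> 'a) \<Rightarrow> 'a \<Rightarrow> 'a set" where
  "alpha_limit \<theta> x =
     {y. \<exists>t. filterlim t at_bot sequentially \<and> (\<lambda>n. \<theta> (t n) x) \<longlonglongrightarrow> y}"

definition nbhd :: "'a::metric_space set \<Rightarrow> 'a set \<Rightarrow> bool" where
  "nbhd U X \<longleftrightarrow> X \<subseteq> interior U"

definition minimal_set :: "(real \<Rightarrow> 'a::metric_space \<Rightarrow> 'a) \<Rightarrow> 'a set \<Rightarrow> bool" where
  "minimal_set \<theta> X \<longleftrightarrow>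
     X \<noteq> {} \<and> closed X \<and> invariant \<theta> X \<and>
     \<not> (\<exists>Y. Y \<subset> X \<and> Y \<noteq> {} \<and> closed Y \<and> invariant \<theta> Y)"

definition CMin :: "(real \<Rightarrow> 'a::metric_space \<Rightarrow> 'a) \<Rightarrow> 'a set set" where
  "CMin \<theta> = {X. compact X \<and> minimal_set \<theta> X}"

text \<open>The notions from here up to \<open>isolated_from_minimals\<close> are meant for nonempty compact
  invariant sets \<open>X\<close>; they are only applied to members of \<open>CMin \<theta>\<close>.\<close>

definition pos_basin :: "(real \<Rightarrow> 'a::metric_space \<Rightarrow> 'a) \<Rightarrow> 'a set \<Rightarrow> 'a set" where
  "pos_basin \<theta> X = {x. omega_limit \<theta> x \<noteq> {} \<and> omega_limit \<theta> x \<subseteq> X}"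

definition neg_basin :: "(real \<Rightarrow> 'a::metric_space \<Rightarrow> 'a) \<Rightarrow> 'a set \<Rightarrow> 'a set" where
  "neg_basin \<theta> X = {x. alpha_limit \<theta> x \<noteq> {} \<and> alpha_limit \<theta> x \<subseteq> X}"

definition stable :: "(real \<Rightarrow> 'a::metric_space \<Rightarrow> 'a) \<Rightarrow> 'a set \<Rightarrow> bool" where
  "stable \<theta> X \<longleftrightarrow> (\<forall>U. nbhd U X \<longrightarrow> (\<exists>V. nbhd V X \<and> pos_orbits \<theta> V \<subseteq> U))"

definition neg_stable :: "(real \<Rightarrow> 'a::metric_space \<Rightarrow> 'a) \<Rightarrow> 'a set \<Rightarrow> bool" where
  "neg_stable \<theta> X \<longleftrightarrow> (\<forall>U. nbhd U X \<longrightarrow> (\<exists>V. nbhd V X \<and> neg_orbits \<theta> V \<subseteq> U))"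

definition attractor :: "(real \<Rightarrow> 'a::metric_space \<Rightarrow> 'a) \<Rightarrow> 'a set \<Rightarrow> bool" where
  "attractor \<theta> X \<longleftrightarrow> stable \<theta> X \<and> nbhd (pos_basin \<theta> X) X"

definition repeller :: "(real \<Rightarrow> 'a::metric_space \<Rightarrow> 'a) \<Rightarrow> 'a set \<Rightarrow> bool" where
  "repeller \<theta> X \<longleftrightarrow> neg_stable \<theta> X \<and> nbhd (neg_basin \<theta> X) X"

definition stagnant :: "(real \<Rightarrow> 'a::metric_space \<Rightarrow> 'a) \<Rightarrow> 'a set \<Rightarrow> bool" where
  "stagnant \<theta> X \<longleftrightarrow>
     (\<exists>x y. x \<notin> X \<and> y \<notin> X \<and>
        alpha_limit \<theta> x \<noteq> {} \<and> alpha_limit \<theta> x \<subseteq> X \<and>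
        omega_limit \<theta> y \<noteq> {} \<and> omega_limit \<theta> y \<subseteq> X)"

definition isolated_from_minimals :: "(real \<Rightarrow> 'a::metric_space \<Rightarrow> 'a) \<Rightarrow> 'a set \<Rightarrow> bool" where
  "isolated_from_minimals \<theta> X \<longleftrightarrow>
     (\<exists>U. nbhd U X \<and> \<not> (\<exists>Y. minimal_set \<theta> Y \<and> Y \<subseteq> U - X))"

definition infinite_height :: "(real \<Rightarrow> 'a::metric_space \<Rightarrow> 'a) \<Rightarrow> 'a set \<Rightarrow> bool" where
  "infinite_height \<theta> \<gamma>\<^sub>0 \<longleftrightarrow>
     (\<exists>\<gamma> :: nat \<Rightarrow> 'a set. \<gamma> 0 = \<gamma>\<^sub>0 \<and> (\<forall>n. \<gamma> n \<in> range (orbit \<theta>)) \<and>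
        (\<forall>n. closure (\<gamma> (Suc n)) \<subset> closure (\<gamma> n)))"

definition AMin :: "(real \<Rightarrow> 'a::metric_space \<Rightarrow> 'a) \<Rightarrow> 'a set set" where
  "AMin \<theta> =
     {X \<in> CMin \<theta>. attractor \<theta> X \<or> repeller \<theta> X \<or> (isolated_from_minimals \<theta> X \<and> stagnant \<theta> X)}"

text \<open>Outside the nonempty compact sets the suprema may be infinite; the default value 0
  serves only to satisfy the locale axioms of \<open>Metric_space\<close>, some of which are not
  relativised to the carrier.\<close>

definition hausdorff_dist :: "'a::metric_space set \<Rightarrow> 'a set \<Rightarrow> real" where
  "hausdorff_dist X Y =
     (if compact X \<and> X \<noteq> {} \<and> compact Y \<and> Y \<noteq> {}
      then max (SUP x\<in>X. infdist x Y) (SUP y\<in>Y. infdist y X) else 0)"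

lemma bdd_above_infdist:
  fixes X Y :: "'a::metric_space set"
  assumes "compact X"
  shows "bdd_above ((\<lambda>x. infdist x Y) ` X)"
  by (intro bounded_imp_bdd_above compact_imp_bounded compact_continuous_image
        continuous_intros assms)

lemma hausdorff_dist_le_iff:
  fixes X Y :: "'a::metric_space set"
  assumes "compact X" "X \<noteq> {}" "compact Y" "Y \<noteq> {}"
  shows "hausdorff_dist X Y \<le> e \<longleftrightarrow> (\<forall>x\<in>X. infdist x Y \<le> e) \<and> (\<forall>y\<in>Y. infdist y X \<le> e)"
  using assms by (simp add: hausdorff_dist_def cSUP_le_iff bdd_above_infdist)

lemma infdist_le_hausdorff_dist:
  fixes X Y :: "'a::metric_space set"
  assumes "compact X" "X \<noteq> {}" "compact Y" "Y \<noteq> {}" "x \<in> X"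
  shows "infdist x Y \<le> hausdorff_dist X Y"
  using hausdorff_dist_le_iff[OF assms(1-4), of "hausdorff_dist X Y"] assms(5) by simp

lemma hausdorff_dist_commute: "hausdorff_dist X Y = hausdorff_dist Y X"
  by (auto simp: hausdorff_dist_def max.commute)

lemma hausdorff_dist_nonneg: "0 \<le> hausdorff_dist X Y"
proof (cases "compact X \<and> X \<noteq> {} \<and> compact Y \<and> Y \<noteq> {}")
  case True
  then obtain x where "x \<in> X" by blast
  with True show ?thesis
    using infdist_le_hausdorff_dist[of X Y x] infdist_nonneg[of x Y] by auto
qed (auto simp: hausdorff_dist_def)

lemma infdist_triangle_hausdorff_dist:
  fixes Y Z :: "'a::metric_space set"
  assumes "compact Y" "Y \<noteq> {}" "compact Z" "Z \<noteq> {}"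
  shows "infdist x Z \<le> infdist x Y + hausdorff_dist Y Z"
proof -
  have "infdist x Z - hausdorff_dist Y Z \<le> dist x y" if "y \<in> Y" for y
    using infdist_triangle[of x Z y] infdist_le_hausdorff_dist[OF assms that] by linarith
  then have "infdist x Z - hausdorff_dist Y Z \<le> infdist x Y"
    unfolding infdist_notempty[OF assms(2)] by (intro cINF_greatest assms(2))
  then show ?thesis by linarith
qed

lemma Metric_space_hausdorff_dist:
  "Metric_space {X :: 'a::metric_space set. compact X \<and> X \<noteq> {}} hausdorff_dist"
proof
  fix X Y :: "'a set"
  show "0 \<le> hausdorff_dist X Y"
    by (rule hausdorff_dist_nonneg)
  show "hausdorff_dist X Y = hausdorff_dist Y X"
    by (rule hausdorff_dist_commute)
next
  fix X Y :: "'a set"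
  assume "X \<in> {X. compact X \<and> X \<noteq> {}}" "Y \<in> {X. compact X \<and> X \<noteq> {}}"
  then have c: "compact X" "X \<noteq> {}" "compact Y" "Y \<noteq> {}" by auto
  have "X = Y" if "hausdorff_dist X Y = 0"
  proof -
    from that have "(\<forall>x\<in>X. infdist x Y \<le> 0) \<and> (\<forall>y\<in>Y. infdist y X \<le> 0)"
      using hausdorff_dist_le_iff[OF c, of 0] by simp
    then have "(\<forall>x\<in>X. infdist x Y = 0) \<and> (\<forall>y\<in>Y. infdist y X = 0)"
      by (meson infdist_nonneg order_antisym)
    then show ?thesis
      using in_closed_iff_infdist_zero[OF compact_imp_closed[OF c(1)] c(2)]
        in_closed_iff_infdist_zero[OF compact_imp_closed[OF c(3)] c(4)] by blast
  qed
  moreover have "hausdorff_dist X X \<le> 0"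
    using hausdorff_dist_le_iff[OF c(1,2) c(1,2), of 0] by simp
  ultimately show "hausdorff_dist X Y = 0 \<longleftrightarrow> X = Y"
    using hausdorff_dist_nonneg[of X X] by auto
next
  fix X Y Z :: "'a set"
  assume "X \<in> {X. compact X \<and> X \<noteq> {}}" "Y \<in> {X. compact X \<and> X \<noteq> {}}"
    "Z \<in> {X. compact X \<and> X \<noteq> {}}"
  then have c: "compact X" "X \<noteq> {}" "compact Y" "Y \<noteq> {}" "compact Z" "Z \<noteq> {}" by auto
  have "infdist x Z \<le> hausdorff_dist X Y + hausdorff_dist Y Z" if "x \<in> X" for x
    using infdist_triangle_hausdorff_dist[OF c(3-6), of x]
      infdist_le_hausdorff_dist[OF c(1-4) that] by linarith
  moreover have "infdist z X \<le> hausdorff_dist X Y + hausdorff_dist Y Z" if "z \<in> Z" for z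
    using infdist_triangle_hausdorff_dist[OF c(3,4,1,2), of z]
      infdist_le_hausdorff_dist[OF c(5,6,3,4) that]
      hausdorff_dist_commute[of X Y] hausdorff_dist_commute[of Y Z] by linarith
  ultimately show "hausdorff_dist X Z \<le> hausdorff_dist X Y + hausdorff_dist Y Z"
    using hausdorff_dist_le_iff[OF c(1,2,5,6)] by blast
qed

lemma Metric_space_CMin: "Metric_space (CMin \<theta>) hausdorff_dist"
  by (rule Metric_space.subspace[OF Metric_space_hausdorff_dist])
    (auto simp: CMin_def minimal_set_def)

abbreviation CMin_topology :: "(real \<Rightarrow> 'a::metric_space \<Rightarrow> 'a) \<Rightarrow> 'a set topology" where
  "CMin_topology \<theta> \<equiv> Metric_space.mtopology (CMin \<theta>) hausdorff_dist"

end

theory Submission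
  imports Defs
begin

text \<open>
  Everything hinges on the compact minimal sets that are isolated from minimals: they are exactly
  the members of \<open>AMin \<theta>\<close>.

  An attractor attracts a neighbourhood, and a minimal set meeting its basin contains an
  \<open>\<omega>\<close>-limit set lying in the attractor, hence meets it; so attractors and,
  by time reversal, repellers are isolated from minimals. Conversely
  (\<open>isolated_from_minimals_imp_AMin\<close>), let \<open>U\<close> be a compact neighbourhood of
  \<open>X\<close> in which \<open>X\<close> is the only minimal set. If \<open>U\<close> contains no entire
  orbit outside \<open>X\<close>, the classical argument of Ura and Kimura applies: if \<open>X\<close>
  is not stable, orbits starting ever closer to \<open>X\<close> take ever longer to leave a
  neighbourhood, and a limit of their exit points is a point outside \<open>X\<close> whose
  \<open>\<alpha>\<close>-limit set lies in \<open>X\<close>; symmetrically if \<open>X\<close> is not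
  negatively stable; and a stable \<open>X\<close> is an attractor. If \<open>U\<close> does contain an
  orbit outside \<open>X\<close>, then, as no orbit has infinite height, there is one whose closure
  \<open>K\<close> is minimal among the closures of such orbits. Every orbit in \<open>K\<close> outside
  \<open>X\<close> is dense in \<open>K\<close>, so within \<open>K\<close> a small neighbourhood of
  \<open>X\<close> contains no entire orbit outside \<open>X\<close>, whereas every orbit in \<open>K\<close>
  comes back near \<open>X\<close> in both time directions. The same exit argument carried out
  inside \<open>K\<close> shows that \<open>X\<close> is stagnant.

  Openness follows because minimal sets are equal or disjoint: a compact minimal set close to
  \<open>X\<close> in the Hausdorff metric lies in a prescribed neighbourhood of \<open>X\<close>, so
  being isolated from minimals makes \<open>X\<close> an isolated point of \<open>CMin \<theta>\<close>.

  Density is a category argument. If some open set containing a compact minimal set contained none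
  that is isolated from minimals, then there would be a decreasing sequence of compact sets, each a
  neighbourhood of a compact minimal set, the \<open>n\<close>-th step being chosen to exclude the
  \<open>n\<close>-th member of an enumeration of \<open>CMin \<theta>\<close>. The orbits contained in all
  of these sets form a nonempty compact invariant set; it contains a compact minimal set, which
  cannot be in the enumeration. Finally, a compact minimal set contained in a small neighbourhood
  of \<open>X\<close> is automatically close to \<open>X\<close> in the Hausdorff metric, since by
  minimality orbits passing near \<open>X\<close> come close to every point of \<open>X\<close>.
\<close>

section \<open>Continuous flows\<close>

lemma flow_zero: "C0_flow \<theta> \<Longrightarrow> \<theta> 0 x = x"
  and flow_add: "C0_flow \<theta> \<Longrightarrow> \<theta> (s + t) x = \<theta> s (\<theta> t x)"
  by (simp_all add: C0_flow_def)

lemma flow_minus_cancel: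
  assumes "C0_flow \<theta>"
  shows "\<theta> (- t) (\<theta> t x) = x"
  using flow_add[OF assms, of "- t" t x] flow_zero[OF assms, of x] by simp

lemma continuous_on_flow:
  assumes "C0_flow \<theta>" and "continuous_on S f" and "continuous_on S g"
  shows "continuous_on S (\<lambda>z. \<theta> (f z) (g z))"
proof -
  have "continuous_on UNIV (\<lambda>p. \<theta> (fst p) (snd p))"
    using assms(1) by (simp add: C0_flow_def case_prod_beta)
  from continuous_on_compose2[OF this continuous_on_Pair[OF assms(2,3)]]
  show ?thesis by simp
qed

lemma tendsto_flow:
  assumes "C0_flow \<theta>" and "(f \<longlongrightarrow> x) F"
  shows "((\<lambda>n. \<theta> s (f n)) \<longlongrightarrow> \<theta> s x) F"
proof -
  have "continuous_on UNIV (\<lambda>z. \<theta> s z)"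
    by (intro continuous_on_flow[OF assms(1)] continuous_intros)
  from continuous_on_tendsto_compose[OF this assms(2)] show ?thesis by simp
qed

lemma open_flow_vimage:
  assumes "C0_flow \<theta>" and "open O'"
  shows "open {x. \<theta> s x \<in> O'}"
proof -
  have "continuous_on UNIV (\<lambda>z. \<theta> s z)"
    by (intro continuous_on_flow[OF assms(1)] continuous_intros)
  from open_vimage[OF assms(2) this] show ?thesis by (simp add: vimage_def)
qed

lemma self_in_orbit: "C0_flow \<theta> \<Longrightarrow> x \<in> orbit \<theta> x"
  unfolding orbit_def by (metis flow_zero rangeI)

lemma invariant_iff:
  assumes "C0_flow \<theta>"
  shows "invariant \<theta> X \<longleftrightarrow> (\<forall>x\<in>X. \<forall>t. \<theta> t x \<in> X)"
proof
  assume "invariant \<theta> X"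
  then obtain S where S: "X = (\<Union>x\<in>S. orbit \<theta> x)" by (auto simp: invariant_def)
  show "\<forall>x\<in>X. \<forall>t. \<theta> t x \<in> X"
  proof (intro ballI allI)
    fix x t assume "x \<in> X"
    then obtain y s where "y \<in> S" "x = \<theta> s y" by (auto simp: S orbit_def)
    then have "\<theta> t x \<in> orbit \<theta> y"
      unfolding orbit_def using flow_add[OF assms, of t s y] by (metis rangeI)
    with \<open>y \<in> S\<close> show "\<theta> t x \<in> X" by (auto simp: S)
  qed
next
  assume "\<forall>x\<in>X. \<forall>t. \<theta> t x \<in> X"
  then have "X = (\<Union>x\<in>X. orbit \<theta> x)"
    using self_in_orbit[OF assms] by (auto simp: orbit_def)
  then show "invariant \<theta> X" by (auto simp: invariant_def)
qed

lemma invariant_closure: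
  assumes "C0_flow \<theta>" and "invariant \<theta> X"
  shows "invariant \<theta> (closure X)"
  unfolding invariant_iff[OF assms(1)]
proof (intro ballI allI)
  fix x t assume "x \<in> closure X"
  then obtain f where f: "\<And>n. f n \<in> X" "f \<longlonglongrightarrow> x" by (auto simp: closure_sequential)
  have "\<And>n. \<theta> t (f n) \<in> X" using f(1) assms(2) by (simp add: invariant_iff[OF assms(1)])
  with tendsto_flow[OF assms(1) f(2), of t] show "\<theta> t x \<in> closure X"
    unfolding closure_sequential by (intro exI[of _ "\<lambda>n. \<theta> t (f n)"]) simp
qed

lemma invariant_orbit: "invariant \<theta> (orbit \<theta> x)"
  unfolding invariant_def by (rule exI[of _ "{x}"]) simp

lemma orbit_subset_invariant:
  assumes "C0_flow \<theta>" and "invariant \<theta> X" and "x \<in> X"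
  shows "orbit \<theta> x \<subseteq> X"
  using assms by (auto simp: invariant_iff orbit_def)

lemma closure_orbit_subset:
  assumes "C0_flow \<theta>" and "invariant \<theta> X" and "closed X" and "x \<in> X"
  shows "closure (orbit \<theta> x) \<subseteq> X"
  by (intro closure_minimal orbit_subset_invariant assms)

text \<open>Close to a closed invariant set all motions follow it for a prescribed length of time,
  because the time interval \<open>{0..T}\<close> is compact.\<close>

lemma exists_nbhd_staying_until:
  assumes fl: "C0_flow \<theta>" and "invariant \<theta> X" and "open O'" and "X \<subseteq> O'"
  shows "\<exists>W. open W \<and> X \<subseteq> W \<and> (\<forall>x\<in>W. \<forall>s\<in>{0..T}. \<theta> s x \<in> O')"
proof -
  define W where "W = {x. \<forall>s\<in>{0..T}. \<theta> s x \<in> O'}"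
  have "continuous_on UNIV (\<lambda>p. \<theta> (snd p) (fst p))"
    by (intro continuous_on_flow[OF fl] continuous_intros)
  then have op: "open ((\<lambda>p. \<theta> (snd p) (fst p)) -` O')"
    using \<open>open O'\<close> by (rule open_vimage[rotated])
  have "open W"
    unfolding open_subopen[of W]
  proof
    fix x assume "x \<in> W"
    then have "{x} \<times> {0..T} \<subseteq> (\<lambda>p. \<theta> (snd p) (fst p)) -` O'" by (auto simp: W_def)
    from Elementary_Topology.tube_lemma[OF compact_Icc op this]
    show "\<exists>N. open N \<and> x \<in> N \<and> N \<subseteq> W" by (fastforce simp: W_def)
  qed
  moreover have "X \<subseteq> W" using assms(2,4) by (auto simp: W_def invariant_iff[OF fl])
  ultimately show ?thesis by (auto simp: W_def)
qed

section \<open>Time reversal\<close>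

text \<open>Reversing time exchanges \<open>\<omega>\<close>- and \<open>\<alpha>\<close>-limit sets, stability and
  negative stability, attractors and repellers, and preserves orbits and minimal sets. Each
  statement below is therefore proved for one time direction only.\<close>

definition reversed :: "(real \<Rightarrow> 'a \<Rightarrow> 'a) \<Rightarrow> real \<Rightarrow> 'a \<Rightarrow> 'a" where
  "reversed \<theta> t x = \<theta> (- t) x"

lemma reversed_reversed [simp]: "reversed (reversed \<theta>) = \<theta>"
  by (simp add: reversed_def fun_eq_iff)

lemma C0_flow_reversed:
  assumes "C0_flow \<theta>"
  shows "C0_flow (reversed \<theta>)"
proof -
  have "continuous_on UNIV (\<lambda>p. \<theta> (- fst p) (snd p))"
    by (intro continuous_on_flow[OF assms] continuous_intros)
  then show ?thesis
    using flow_zero[OF assms] flow_add[OF assms, symmetric]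
    by (simp add: C0_flow_def reversed_def case_prod_beta)
qed

lemma orbit_reversed [simp]: "orbit (reversed \<theta>) = orbit \<theta>"
proof
  fix x
  have "range (\<lambda>t. \<theta> (- t) x) = (\<lambda>t. \<theta> t x) ` range uminus" by (simp only: image_image)
  then show "orbit (reversed \<theta>) x = orbit \<theta> x" by (simp add: orbit_def reversed_def)
qed

lemma invariant_reversed [simp]: "invariant (reversed \<theta>) = invariant \<theta>"
  by (simp add: invariant_def fun_eq_iff)

lemma minimal_set_reversed [simp]: "minimal_set (reversed \<theta>) = minimal_set \<theta>"
  by (simp add: minimal_set_def fun_eq_iff)

lemma CMin_reversed [simp]: "CMin (reversed \<theta>) = CMin \<theta>"
  by (simp add: CMin_def)

lemma infinite_height_reversed [simp]: "infinite_height (reversed \<theta>) = infinite_height \<theta>"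
  by (simp add: infinite_height_def fun_eq_iff)

lemma omega_limit_reversed [simp]: "omega_limit (reversed \<theta>) = alpha_limit \<theta>"
proof (intro ext set_eqI iffI)
  fix x y
  assume "y \<in> omega_limit (reversed \<theta>) x"
  then obtain t where "filterlim t at_top sequentially" "(\<lambda>n. \<theta> (- t n) x) \<longlonglongrightarrow> y"
    by (auto simp: omega_limit_def reversed_def)
  then show "y \<in> alpha_limit \<theta> x"
    unfolding alpha_limit_def
    by (auto intro!: exI[of _ "\<lambda>n. - t n"] filterlim_compose[OF filterlim_uminus_at_bot_at_top])
next
  fix x y
  assume "y \<in> alpha_limit \<theta> x"
  then obtain t where "filterlim t at_bot sequentially" "(\<lambda>n. \<theta> (t n) x) \<longlonglongrightarrow> y"
    by (auto simp: alpha_limit_def)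
  then show "y \<in> omega_limit (reversed \<theta>) x"
    unfolding omega_limit_def reversed_def
    by (auto intro!: exI[of _ "\<lambda>n. - t n"] filterlim_compose[OF filterlim_uminus_at_top_at_bot])
qed

lemma alpha_limit_reversed [simp]: "alpha_limit (reversed \<theta>) = omega_limit \<theta>"
  by (metis omega_limit_reversed reversed_reversed)

lemma neg_orbits_reversed [simp]: "neg_orbits (reversed \<theta>) = pos_orbits \<theta>"
proof -
  have "{..0::real} = uminus ` {0..}" by simp
  then show ?thesis
    unfolding neg_orbits_def pos_orbits_def reversed_def by (simp only: image_image) simp
qed

lemma stable_reversed [simp]: "stable (reversed \<theta>) = neg_stable \<theta>"
proof -
  have "pos_orbits (reversed \<theta>) = neg_orbits \<theta>" by (metis neg_orbits_reversed reversed_reversed)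
  then show ?thesis by (simp add: stable_def neg_stable_def fun_eq_iff)
qed

lemma pos_basin_reversed [simp]: "pos_basin (reversed \<theta>) = neg_basin \<theta>"
  by (simp add: pos_basin_def neg_basin_def fun_eq_iff)

lemma attractor_reversed [simp]: "attractor (reversed \<theta>) = repeller \<theta>"
  by (simp add: attractor_def repeller_def fun_eq_iff)

lemma isolated_from_minimals_reversed [simp]:
  "isolated_from_minimals (reversed \<theta>) = isolated_from_minimals \<theta>"
  by (simp add: isolated_from_minimals_def fun_eq_iff)

section \<open>Limit sets\<close>

lemma omega_limit_flow:
  assumes fl: "C0_flow \<theta>" and "y \<in> omega_limit \<theta> x"
  shows "\<theta> s y \<in> omega_limit \<theta> x"
proof -
  obtain t where t: "filterlim t at_top sequentially" "(\<lambda>n. \<theta> (t n) x) \<longlonglongrightarrow> y"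
    using assms(2) by (auto simp: omega_limit_def)
  have "filterlim (\<lambda>n. s + t n) at_top sequentially"
    by (rule filterlim_tendsto_add_at_top[OF tendsto_const t(1)])
  moreover have "(\<lambda>n. \<theta> (s + t n) x) \<longlonglongrightarrow> \<theta> s y"
    using tendsto_flow[OF fl t(2), of s] by (simp add: flow_add[OF fl])
  ultimately show ?thesis unfolding omega_limit_def by blast
qed

lemma omega_limit_subset_closed:
  assumes "closed C" and C: "\<And>t. t \<ge> 0 \<Longrightarrow> \<theta> t x \<in> C"
  shows "omega_limit \<theta> x \<subseteq> C"
proof
  fix y assume "y \<in> omega_limit \<theta> x"
  then obtain t where t: "filterlim t at_top sequentially" "(\<lambda>n. \<theta> (t n) x) \<longlonglongrightarrow> y"
    by (auto simp: omega_limit_def)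
  have "\<forall>\<^sub>F n in sequentially. t n \<ge> 0" using t(1) by (simp add: filterlim_at_top)
  then have "\<forall>\<^sub>F n in sequentially. \<theta> (t n) x \<in> C" by eventually_elim (rule C)
  from Lim_in_closed_set[OF assms(1) this _ t(2)] show "y \<in> C" by simp
qed

lemma omega_limit_nonempty:
  fixes \<theta> :: "real \<Rightarrow> 'a::metric_space \<Rightarrow> 'a"
  assumes "compact C" and C: "\<And>t. t \<ge> 0 \<Longrightarrow> \<theta> t x \<in> C"
  shows "omega_limit \<theta> x \<noteq> {}"
proof -
  obtain y r where r: "strict_mono r" "((\<lambda>n. \<theta> (real n) x) \<circ> r) \<longlonglongrightarrow> y"
    by (rule seq_compactE[OF compact_imp_seq_compact[OF assms(1)], of "\<lambda>n. \<theta> (real n) x"])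
      (use C in auto)
  have "filterlim (\<lambda>n. real (r n)) at_top sequentially"
    by (rule filterlim_compose[OF filterlim_real_sequentially filterlim_subseq[OF r(1)]])
  with r(2) have "y \<in> omega_limit \<theta> x" unfolding omega_limit_def comp_def by blast
  then show ?thesis by blast
qed

lemma alpha_limit_flow:
  assumes "C0_flow \<theta>" and "y \<in> alpha_limit \<theta> x"
  shows "\<theta> s y \<in> alpha_limit \<theta> x"
  using omega_limit_flow[OF C0_flow_reversed[OF assms(1)], of y x "- s"] assms(2)
  by (simp add: reversed_def[of \<theta> "- s"])

lemma alpha_limit_subset_closed:
  assumes "closed C" and "\<And>t. t \<le> 0 \<Longrightarrow> \<theta> t x \<in> C"
  shows "alpha_limit \<theta> x \<subseteq> C"
  using omega_limit_subset_closed[of C "reversed \<theta>" x] assms by (simp add: reversed_def)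

lemma alpha_limit_nonempty:
  fixes \<theta> :: "real \<Rightarrow> 'a::metric_space \<Rightarrow> 'a"
  assumes "compact C" and "\<And>t. t \<le> 0 \<Longrightarrow> \<theta> t x \<in> C"
  shows "alpha_limit \<theta> x \<noteq> {}"
  using omega_limit_nonempty[of C "reversed \<theta>" x] assms by (simp add: reversed_def)

section \<open>Compact minimal sets\<close>

lemma CMin_D:
  assumes "X \<in> CMin \<theta>"
  shows "compact X" "closed X" "X \<noteq> {}" "invariant \<theta> X" "minimal_set \<theta> X"
  using assms by (auto simp: CMin_def minimal_set_def)

text \<open>A minimal set meets a closed invariant set in a closed invariant subset of itself, so the
  intersection is either empty or everything.\<close>
lemma minimal_set_subset_closed_invariant:
  assumes fl: "C0_flow \<theta>" and "minimal_set \<theta> X" and "closed Y" and "invariant \<theta> Y"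
    and "X \<inter> Y \<noteq> {}"
  shows "X \<subseteq> Y"
proof -
  have "closed X" "invariant \<theta> X" using assms(2) by (simp_all add: minimal_set_def)
  then have "closed (X \<inter> Y)" "invariant \<theta> (X \<inter> Y)"
    using assms(3,4) by (simp_all add: closed_Int invariant_iff[OF fl])
  moreover have "\<not> (X \<inter> Y \<subset> X \<and> X \<inter> Y \<noteq> {} \<and> closed (X \<inter> Y) \<and> invariant \<theta> (X \<inter> Y))"
    using assms(2)[unfolded minimal_set_def, THEN conjunct2, THEN conjunct2, THEN conjunct2]
    by (rule contrapos_nn) (rule exI)
  ultimately have "\<not> X \<inter> Y \<subset> X" using assms(5) by simp
  then show ?thesis by auto
qed

lemma minimal_sets_disjoint_or_equal:
  assumes "C0_flow \<theta>" and "minimal_set \<theta> X" and "minimal_set \<theta> Y" and "X \<inter> Y \<noteq> {}"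
  shows "X = Y"
  using minimal_set_subset_closed_invariant[OF assms(1,2), of Y]
    minimal_set_subset_closed_invariant[OF assms(1,3), of X] assms
  by (auto simp: minimal_set_def)

lemma minimal_subset_compact_in_CMin:
  assumes "minimal_set \<theta> Y" and "Y \<subseteq> U" and "compact U"
  shows "Y \<in> CMin \<theta>"
  using assms compact_Int_closed[of U Y] by (simp add: CMin_def minimal_set_def Int_absorb1)

text \<open>The absence of orbits of infinite height is a descending chain condition on orbit closures,
  hence a minimality principle. It is used both to find minimal sets and, with a predicate
  \<open>P\<close> that excludes a given minimal set, to find the next simplest orbits.\<close>
lemma exists_minimal_orbit_closure:
  assumes nh: "\<not> (\<exists>x. infinite_height \<theta> (orbit \<theta> x))" and "P x"
  obtains z where "P z"
    and "\<forall>w. P w \<longrightarrow> closure (orbit \<theta> w) \<subseteq> closure (orbit \<theta> z)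
      \<longrightarrow> closure (orbit \<theta> w) = closure (orbit \<theta> z)"
proof -
  let ?R = "{(w, z). closure (orbit \<theta> w) \<subset> closure (orbit \<theta> z)}"
  have "wf ?R"
    unfolding wf_iff_no_infinite_down_chain
  proof
    assume "\<exists>f. \<forall>i. (f (Suc i), f i) \<in> ?R"
    then obtain f where "\<forall>i. closure (orbit \<theta> (f (Suc i))) \<subset> closure (orbit \<theta> (f i))" by auto
    then have "infinite_height \<theta> (orbit \<theta> (f 0))"
      unfolding infinite_height_def by (intro exI[of _ "\<lambda>n. orbit \<theta> (f n)"]) auto
    with nh show False by blast
  qed
  then obtain z where "P z" and z: "\<And>w. (w, z) \<in> ?R \<Longrightarrow> w \<notin> Collect P"
    by (rule wfE_min[of ?R x "Collect P"]) (use \<open>P x\<close> in auto)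
  show thesis
  proof (rule that[of z]; (intro allI impI)?)
    fix w assume "P w" "closure (orbit \<theta> w) \<subseteq> closure (orbit \<theta> z)"
    with z[of w] show "closure (orbit \<theta> w) = closure (orbit \<theta> z)" by (auto simp: psubset_eq)
  qed (fact \<open>P z\<close>)
qed

text \<open>An orbit closure that is minimal among those in \<open>A\<close> is a minimal set, since any point
  of a closed invariant subset already generates the whole closure.\<close>
lemma exists_CMin_subset:
  assumes fl: "C0_flow \<theta>" and nh: "\<not> (\<exists>x. infinite_height \<theta> (orbit \<theta> x))"
    and A: "compact A" "A \<noteq> {}" "invariant \<theta> A"
  shows "\<exists>Y\<in>CMin \<theta>. Y \<subseteq> A"
proof -
  obtain a where "a \<in> A" using A(2) by blast
  obtain z where z: "z \<in> A"
    and min: "\<forall>w. w \<in> A \<longrightarrow> closure (orbit \<theta> w) \<subseteq> closure (orbit \<theta> z)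
      \<longrightarrow> closure (orbit \<theta> w) = closure (orbit \<theta> z)"
    by (rule exists_minimal_orbit_closure[where P = "\<lambda>z. z \<in> A", OF nh \<open>a \<in> A\<close>])
  let ?Y = "closure (orbit \<theta> z)"
  have sub: "?Y \<subseteq> A"
    by (rule closure_orbit_subset[OF fl A(3) compact_imp_closed[OF A(1)] z])
  have "minimal_set \<theta> ?Y"
    unfolding minimal_set_def
  proof (intro conjI notI)
    assume "\<exists>Y. Y \<subset> ?Y \<and> Y \<noteq> {} \<and> closed Y \<and> invariant \<theta> Y"
    then obtain Y w where Y: "Y \<subset> ?Y" "closed Y" "invariant \<theta> Y" and "w \<in> Y" by blast
    have "closure (orbit \<theta> w) \<subseteq> Y" by (rule closure_orbit_subset[OF fl Y(3,2) \<open>w \<in> Y\<close>])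
    moreover have "w \<in> A" using \<open>w \<in> Y\<close> Y(1) sub by auto
    ultimately have "?Y \<subseteq> Y" using min Y(1) by (metis order_trans psubset_imp_subset)
    with Y(1) show False by auto
  qed (use self_in_orbit[OF fl, of z] in
      \<open>auto intro: invariant_closure[OF fl invariant_orbit]\<close>)
  from minimal_subset_compact_in_CMin[OF this sub A(1)] sub show ?thesis by blast
qed

lemma exists_compact_nbhd:
  fixes X :: "'a::metric_space set"
  assumes "locally compact (UNIV :: 'a set)" and "compact X" and "open O'" and "X \<subseteq> O'"
  shows "\<exists>V. compact V \<and> X \<subseteq> interior V \<and> V \<subseteq> O'"
proof -
  have "\<exists>u v. open u \<and> compact v \<and> x \<in> u \<and> u \<subseteq> v \<and> v \<subseteq> O'" if "x \<in> X" for x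
    using assms that unfolding locally_def by (metis open_openin subsetD subtopology_UNIV)
  then obtain u v where uv: "\<And>x. x \<in> X \<Longrightarrow> open (u x) \<and> compact (v x) \<and> x \<in> u x \<and> u x \<subseteq> v x \<and> v x \<subseteq> O'"
    by metis
  have "X \<subseteq> (\<Union>c\<in>X. u c)" using uv by blast
  with uv obtain C where C: "C \<subseteq> X" "finite C" "X \<subseteq> (\<Union>c\<in>C. u c)"
    by (auto intro: compactE_image[OF assms(2), of X u])
  have "compact (\<Union>c\<in>C. v c)" using C uv by (intro compact_UN) auto
  moreover have "(\<Union>c\<in>C. u c) \<subseteq> interior (\<Union>c\<in>C. v c)"
    using C(1) uv by (intro interior_maximal open_UN) blast+
  moreover have "(\<Union>c\<in>C. v c) \<subseteq> O'" using C(1) uv by blast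
  ultimately show ?thesis using C(3) by (intro exI[of _ "\<Union>c\<in>C. v c"]) auto
qed

section \<open>Isolation in the Hausdorff metric\<close>

text \<open>Every orbit in \<open>X\<close> is dense in \<open>X\<close>. Hence finitely many balls covering
  \<open>X\<close> are all visited by each orbit through a suitable neighbourhood of \<open>X\<close>, so
  an invariant set in that neighbourhood comes close to every point of \<open>X\<close>.\<close>
lemma exists_nbhd_hausdorff_close:
  assumes fl: "C0_flow \<theta>" and X: "X \<in> CMin \<theta>" and "e > 0"
  shows "\<exists>W. open W \<and> X \<subseteq> W \<and> (\<forall>Y\<in>CMin \<theta>. Y \<subseteq> W \<longrightarrow> hausdorff_dist X Y < e)"
proof -
  \<comment> \<open>The distances are bounded by \<open>2 * d\<close>: one radius for the centre of a ball, one for the visit.\<close>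
  define d where "d = e / 3"
  have "d > 0" using \<open>e > 0\<close> by (simp add: d_def)
  \<comment> \<open>The points whose orbit visits the \<open>d\<close>-ball around \<open>p\<close>.\<close>
  define G where "G p = (\<Union>t. {x. \<theta> t x \<in> ball p d})" for p
  have "open (G p)" for p
    unfolding G_def by (intro open_UN ballI open_flow_vimage[OF fl]) simp
  have cover: "X \<subseteq> G p" if "p \<in> X" for p
  proof
    fix x assume "x \<in> X"
    have "X \<subseteq> closure (orbit \<theta> x)"
      using \<open>x \<in> X\<close> self_in_orbit[OF fl, of x] closure_subset[of "orbit \<theta> x"]
      by (intro minimal_set_subset_closed_invariant[OF fl CMin_D(5)[OF X]]
          invariant_closure[OF fl invariant_orbit]) auto
    with \<open>p \<in> X\<close> \<open>d > 0\<close> obtain y where "y \<in> orbit \<theta> x" "dist y p < d"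
      by (auto simp: closure_approachable subset_iff)
    then show "x \<in> G p" by (auto simp: G_def orbit_def dist_commute)
  qed
  have "X \<subseteq> (\<Union>p\<in>X. ball p d)" using \<open>d > 0\<close> by auto
  then obtain C where C: "finite C" "C \<subseteq> X" "X \<subseteq> (\<Union>p\<in>C. ball p d)"
    by (auto intro: compactE_image[OF CMin_D(1)[OF X], of X "\<lambda>p. ball p d"])
  define W where "W = {x. infdist x X < d} \<inter> (\<Inter>p\<in>C. G p)"
  have "open {x. infdist x X < d}"
    by (intro open_Collect_less continuous_intros)
  then have "open W" unfolding W_def using \<open>\<And>p. open (G p)\<close> C(1) by (intro open_Int open_INT) auto
  moreover have "X \<subseteq> W" using cover C(2) \<open>d > 0\<close> by (auto simp: W_def)
  moreover have "hausdorff_dist X Y < e" if Y: "Y \<in> CMin \<theta>" "Y \<subseteq> W" for Y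
  proof -
    have "infdist x Y \<le> 2 * d" if "x \<in> X" for x
    proof -
      obtain p where p: "p \<in> C" "dist p x < d" using C(3) \<open>x \<in> X\<close> by auto
      obtain y where "y \<in> Y" using CMin_D(3)[OF Y(1)] by blast
      with Y(2) p(1) have "y \<in> G p" by (auto simp: W_def)
      then obtain t where t: "dist p (\<theta> t y) < d" by (auto simp: G_def)
      have "\<theta> t y \<in> Y" using CMin_D(4)[OF Y(1)] \<open>y \<in> Y\<close> by (simp add: invariant_iff[OF fl])
      then have "infdist x Y \<le> dist x (\<theta> t y)" by (rule infdist_le)
      also have "\<dots> \<le> dist p x + dist p (\<theta> t y)" by (rule dist_triangle3)
      finally show ?thesis using t p(2) by linarith
    qed
    moreover have "infdist y X \<le> 2 * d" if "y \<in> Y" for y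
      using that Y(2) \<open>d > 0\<close> by (force simp: W_def)
    ultimately have "hausdorff_dist X Y \<le> 2 * d"
      using CMin_D(1,3)[OF X] CMin_D(1,3)[OF Y(1)] by (subst hausdorff_dist_le_iff) auto
    with \<open>e > 0\<close> show ?thesis by (simp add: d_def)
  qed
  ultimately show ?thesis by blast
qed

lemma hausdorff_close_subset:
  assumes X: "compact X" "X \<noteq> {}" and "open O'" and "X \<subseteq> O'"
  shows "\<exists>e>0. \<forall>Y. compact Y \<and> Y \<noteq> {} \<and> hausdorff_dist X Y < e \<longrightarrow> Y \<subseteq> O'"
proof -
  obtain e where e: "e > 0" "(\<Union>x\<in>X. cball x e) \<subseteq> O'"
    using compact_subset_open_imp_cball_epsilon_subset[OF assms(1,3,4)] by auto
  have "Y \<subseteq> O'" if Y: "compact Y" "Y \<noteq> {}" "hausdorff_dist X Y < e" for Y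
  proof
    fix y assume "y \<in> Y"
    then have "infdist y X \<le> hausdorff_dist Y X"
      by (intro infdist_le_hausdorff_dist Y X)
    then have "infdist y X < e" using Y(3) by (simp add: hausdorff_dist_commute)
    then obtain x where "x \<in> X" "dist y x < e"
      using cInf_lessD[of "dist y ` X" e] X(2) by (auto simp: infdist_notempty)
    then have "y \<in> cball x e" by (simp add: dist_commute)
    with e(2) \<open>x \<in> X\<close> show "y \<in> O'" by blast
  qed
  with e(1) show ?thesis by blast
qed

text \<open>A compact minimal set that is Hausdorff-close to \<open>X\<close> lies in the isolating
  neighbourhood, so it must meet \<open>X\<close>, and then the two coincide.\<close>
lemma isolated_from_minimals_imp_hausdorff_isolated:
  assumes fl: "C0_flow \<theta>" and X: "X \<in> CMin \<theta>" and "isolated_from_minimals \<theta> X"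
  shows "\<exists>e>0. \<forall>Y\<in>CMin \<theta>. hausdorff_dist X Y < e \<longrightarrow> Y = X"
proof -
  obtain U where U: "X \<subseteq> interior U" "\<And>Y. minimal_set \<theta> Y \<Longrightarrow> \<not> Y \<subseteq> U - X"
    using assms(3) by (auto simp: isolated_from_minimals_def nbhd_def)
  obtain e where "e > 0"
    and e: "\<And>Y. \<lbrakk>compact Y; Y \<noteq> {}; hausdorff_dist X Y < e\<rbrakk> \<Longrightarrow> Y \<subseteq> interior U"
    using hausdorff_close_subset[OF CMin_D(1,3)[OF X] open_interior U(1)] by blast
  have "Y = X" if Y: "Y \<in> CMin \<theta>" "hausdorff_dist X Y < e" for Y
  proof -
    have "Y \<subseteq> U" using e[OF CMin_D(1,3)[OF Y(1)] Y(2)] interior_subset[of U] by blast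
    with U(2)[OF CMin_D(5)[OF Y(1)]] have "Y \<inter> X \<noteq> {}" by blast
    from minimal_sets_disjoint_or_equal[OF fl CMin_D(5)[OF Y(1)] CMin_D(5)[OF X] this]
    show ?thesis .
  qed
  with \<open>e > 0\<close> show ?thesis by blast
qed

text \<open>The basin is an isolating neighbourhood: a minimal set in it contains the nonempty
  \<open>\<omega>\<close>-limit set of each of its points, which lies in \<open>X\<close>.\<close>
lemma attractor_imp_isolated_from_minimals:
  assumes fl: "C0_flow \<theta>" and "attractor \<theta> X"
  shows "isolated_from_minimals \<theta> X"
  unfolding isolated_from_minimals_def
proof (intro exI conjI notI)
  show "nbhd (pos_basin \<theta> X) X" using assms(2) by (simp add: attractor_def)
next
  assume "\<exists>Y. minimal_set \<theta> Y \<and> Y \<subseteq> pos_basin \<theta> X - X"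
  then obtain Y y where Y: "closed Y" "invariant \<theta> Y" "Y \<subseteq> pos_basin \<theta> X - X" "y \<in> Y"
    by (auto simp: minimal_set_def)
  have "omega_limit \<theta> y \<subseteq> Y"
    using Y(2,4) by (intro omega_limit_subset_closed Y(1)) (simp add: invariant_iff[OF fl])
  moreover have "omega_limit \<theta> y \<noteq> {}" "omega_limit \<theta> y \<subseteq> X"
    using Y(3,4) by (auto simp: pos_basin_def)
  ultimately show False using Y(3) by blast
qed

lemma AMin_imp_isolated_from_minimals:
  assumes "C0_flow \<theta>" and "X \<in> AMin \<theta>"
  shows "isolated_from_minimals \<theta> X"
  using assms(2) attractor_imp_isolated_from_minimals[OF assms(1), of X]
    attractor_imp_isolated_from_minimals[OF C0_flow_reversed[OF assms(1)], of X]
  by (auto simp: AMin_def)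

section \<open>Density of the compact minimal sets isolated from minimals\<close>

lemma invariant_part_of_compact:
  assumes fl: "C0_flow \<theta>" and "compact U"
  shows "compact {x. orbit \<theta> x \<subseteq> U}" and "invariant \<theta> {x. orbit \<theta> x \<subseteq> U}"
proof -
  have "{x. orbit \<theta> x \<subseteq> U} = U \<inter> (\<Inter>t. - {x. \<theta> t x \<in> - U})"
    using self_in_orbit[OF fl] by (auto simp: orbit_def)
  moreover have "closed (\<Inter>t. - {x. \<theta> t x \<in> - U})"
    using compact_imp_closed[OF assms(2)]
    by (intro closed_INT ballI closed_Compl open_flow_vimage[OF fl]) auto
  ultimately show "compact {x. orbit \<theta> x \<subseteq> U}" using compact_Int_closed[OF assms(2)] by simp
  have "orbit \<theta> (\<theta> t x) \<subseteq> orbit \<theta> x" for t x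
    by (auto simp: orbit_def flow_add[OF fl, symmetric])
  then show "invariant \<theta> {x. orbit \<theta> x \<subseteq> U}" by (auto simp: invariant_iff[OF fl])
qed

text \<open>The category argument, by contradiction. The property \<open>P\<close> of the compact sets chosen
  is that they are neighbourhoods of some compact minimal set; it guarantees that the set of points
  whose orbit stays inside is nonempty, and this is what survives in the intersection.\<close>
lemma exists_isolated_from_minimals_in_nbhd:
  fixes \<theta> :: "real \<Rightarrow> 'a::metric_space \<Rightarrow> 'a"
  assumes fl: "C0_flow \<theta>" and lc: "locally compact (UNIV :: 'a set)"
    and cnt: "countable (CMin \<theta>)"
    and nh: "\<not> (\<exists>x. infinite_height \<theta> (orbit \<theta> x))"
    and X: "X \<in> CMin \<theta>" and W: "open W" "X \<subseteq> W"
  shows "\<exists>Y\<in>CMin \<theta>. Y \<subseteq> W \<and> isolated_from_minimals \<theta> Y"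
proof (rule ccontr)
  assume no: "\<not> ?thesis"
  define e where "e = from_nat_into (CMin \<theta>)"
  have e: "e n \<in> CMin \<theta>" for n using X by (auto simp: e_def intro: from_nat_into)
  define P where "P U \<longleftrightarrow> compact U \<and> U \<subseteq> W \<and> (\<exists>Z\<in>CMin \<theta>. Z \<subseteq> interior U)" for U
  have step: "\<exists>U'. P U' \<and> U' \<subseteq> U \<and> \<not> e n \<subseteq> U'" if "P U" for U n
  proof -
    obtain Z where U: "compact U" "U \<subseteq> W" and Z: "Z \<in> CMin \<theta>" "Z \<subseteq> interior U"
      using \<open>P U\<close> by (auto simp: P_def)
    have "Z \<subseteq> W" using Z(2) U(2) interior_subset[of U] by blast
    with no Z(1) have "\<not> isolated_from_minimals \<theta> Z" by blast
    moreover have "nbhd (interior U) Z" using Z(2) by (simp add: nbhd_def)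
    ultimately obtain Y where Y: "minimal_set \<theta> Y" "Y \<subseteq> interior U - Z"
      unfolding isolated_from_minimals_def by blast
    have YC: "Y \<in> CMin \<theta>"
      using minimal_subset_compact_in_CMin[OF Y(1) _ U(1)] Y(2) interior_subset[of U] by blast
    have "Y \<noteq> Z" using Y(2) CMin_D(3)[OF YC] by blast
    \<comment> \<open>At least one of the two disjoint minimal sets \<open>Z\<close>, \<open>Y\<close> differs from \<open>e n\<close>,
      and \<open>e n\<close> can be avoided by shrinking \<open>U\<close> around that one.\<close>
    define Z' where "Z' = (if e n = Z then Y else Z)"
    have Z': "Z' \<in> CMin \<theta>" "Z' \<subseteq> interior U" "Z' \<noteq> e n"
      using Z YC Y(2) \<open>Y \<noteq> Z\<close> by (auto simp: Z'_def)
    have "Z' \<inter> e n = {}"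
      using minimal_sets_disjoint_or_equal[OF fl CMin_D(5)[OF Z'(1)] CMin_D(5)[OF e]] Z'(3) by blast
    then have "Z' \<subseteq> interior U - e n" using Z'(2) by blast
    from exists_compact_nbhd[OF lc CMin_D(1)[OF Z'(1)] open_Diff[OF open_interior CMin_D(2)[OF e]] this]
    obtain U' where U': "compact U'" "Z' \<subseteq> interior U'" "U' \<subseteq> interior U - e n" by blast
    have "U' \<subseteq> U" using U'(3) interior_subset[of U] by blast
    moreover have "\<not> e n \<subseteq> U'" using U'(3) CMin_D(3)[OF e[of n]] by blast
    ultimately show ?thesis using U'(1,2) Z'(1) U(2) unfolding P_def by blast
  qed
  obtain U0 where "P U0"
    using exists_compact_nbhd[OF lc CMin_D(1)[OF X] W] X by (auto simp: P_def)
  then obtain U where U: "\<And>n. P (U n)" and next': "\<And>n. U (Suc n) \<subseteq> U n \<and> \<not> e n \<subseteq> U (Suc n)"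
    using dependent_nat_choice[of "\<lambda>n. P" "\<lambda>n U U'. U' \<subseteq> U \<and> \<not> e n \<subseteq> U'"] step by metis
  \<comment> \<open>The \<open>U n\<close> are not invariant, so their intersection is replaced by the largest invariant part.\<close>
  define I where "I n = {x. orbit \<theta> x \<subseteq> U n}" for n
  have I: "compact (I n)" "invariant \<theta> (I n)" for n
    using invariant_part_of_compact[OF fl, of "U n"] U by (auto simp: I_def P_def)
  have ne: "I n \<noteq> {}" for n
  proof -
    obtain Z where Z: "Z \<in> CMin \<theta>" "Z \<subseteq> interior (U n)" using U[of n] by (auto simp: P_def)
    then have "Z \<subseteq> I n"
      using orbit_subset_invariant[OF fl CMin_D(4)[OF Z(1)]] interior_subset[of "U n"] by (fastforce simp: I_def)
    with CMin_D(3)[OF Z(1)] show ?thesis by blast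
  qed
  have mono: "I n \<subseteq> I m" if "m \<le> n" for m n
    using lift_Suc_antimono_le[of U m n] next' that by (auto simp: I_def)
  have I_nonempty: "I 0 \<inter> (\<Inter>n. I n) \<noteq> {}"
  proof (rule compact_imp_fip_image)
    fix F :: "nat set" assume "finite F"
    then have "I (Max (insert 0 F)) \<subseteq> I 0 \<inter> (\<Inter>n\<in>F. I n)"
      by (intro Int_greatest INT_greatest mono) auto
    with ne show "I 0 \<inter> (\<Inter>n\<in>F. I n) \<noteq> {}" by blast
  qed (use I compact_imp_closed in auto)
  have I_compact: "compact (I 0 \<inter> (\<Inter>n. I n))"
    using I(1) by (intro compact_Int_closed closed_INT) (auto intro: compact_imp_closed)
  have I_invariant: "invariant \<theta> (I 0 \<inter> (\<Inter>n. I n))"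
    using I(2) by (auto simp: invariant_iff[OF fl])
  from exists_CMin_subset[OF fl nh I_compact I_nonempty I_invariant]
  obtain Y where Y: "Y \<in> CMin \<theta>" "Y \<subseteq> I 0 \<inter> (\<Inter>n. I n)" by blast
  from from_nat_into_surj[OF cnt Y(1)] obtain k where "Y = e k" by (auto simp: e_def)
  moreover have "Y \<subseteq> I (Suc k)" using Y(2) by blast
  moreover have "I (Suc k) \<subseteq> U (Suc k)" using self_in_orbit[OF fl] by (auto simp: I_def)
  ultimately show False using next' by blast
qed

section \<open>Orbits asymptotic to an isolated minimal set\<close>

text \<open>The exit time is the first time outside \<open>O'\<close>. The point reached then is recorded as
  lying in the closure of \<open>O'\<close>, which places it on the boundary.\<close>
lemma exit_point:
  assumes fl: "C0_flow \<theta>" and "x \<in> O'" and "open O'" and "s \<ge> 0" and "\<theta> s x \<notin> O'"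
  shows "\<exists>\<tau>\<ge>0. \<theta> \<tau> x \<notin> O' \<and> \<theta> \<tau> x \<in> closure O' \<and> (\<forall>t. 0 \<le> t \<and> t < \<tau> \<longrightarrow> \<theta> t x \<in> O')"
proof -
  define E where "E = {t \<in> {0..s}. \<theta> t x \<notin> O'}"
  have cont: "continuous_on UNIV (\<lambda>t. \<theta> t x)" by (intro continuous_on_flow[OF fl] continuous_intros)
  have "closed ((\<lambda>t. \<theta> t x) -` (- O'))"
    using \<open>open O'\<close> cont by (intro closed_vimage) auto
  moreover have "E = {0..s} \<inter> (\<lambda>t. \<theta> t x) -` (- O')" by (auto simp: E_def)
  ultimately have "compact E" using compact_Int_closed[OF compact_Icc] by simp
  moreover have "s \<in> E" using assms by (simp add: E_def)
  ultimately obtain \<tau> where \<tau>: "\<tau> \<in> E" "\<And>t. t \<in> E \<Longrightarrow> \<tau> \<le> t"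
    using compact_attains_inf[of E] by blast
  have before: "\<theta> t x \<in> O'" if "0 \<le> t" "t < \<tau>" for t
    using \<tau>(2)[of t] \<tau>(1) that by (auto simp: E_def)
  have "\<tau> \<noteq> 0" using \<tau>(1) \<open>x \<in> O'\<close> flow_zero[OF fl] by (auto simp: E_def)
  then have "\<tau> > 0" using \<tau>(1) by (auto simp: E_def)
  have "((\<lambda>t. \<theta> t x) \<longlongrightarrow> \<theta> \<tau> x) (at_left \<tau>)"
    using continuous_on_subset[OF cont subset_UNIV, of "{..<\<tau>} \<union> {\<tau>}"]
    by (auto simp: continuous_on_def intro: tendsto_within_subset)
  moreover have "\<forall>\<^sub>F t in at_left \<tau>. \<theta> t x \<in> closure O'"
    using eventually_at_left_real[OF \<open>\<tau> > 0\<close>]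
    by eventually_elim (use before closure_subset[of O'] in auto)
  ultimately have "\<theta> \<tau> x \<in> closure O'"
    by (rule Lim_in_closed_set[OF closed_closure, rotated 2]) simp
  with \<tau>(1) before show ?thesis by (auto simp: E_def)
qed

text \<open>The exit argument of Ura and Kimura, relative to a closed invariant set \<open>K\<close>. Points of
  \<open>K\<close> near \<open>X\<close> whose positive orbits leave \<open>V\<close> take long to do so. Their
  exit points lie on the boundary of \<open>V\<close>, away from \<open>X\<close>, and have long backward
  orbit segments in \<open>V\<close>; a limit of them has its entire backward orbit in \<open>V\<close>.
  Its \<open>\<alpha>\<close>-limit set consists of entire orbits in \<open>K\<close> and \<open>V\<close>, which
  by isolation lie in \<open>X\<close>.\<close>
lemma exists_alpha_asymptotic_if_leaving:
  assumes fl: "C0_flow \<theta>" and K: "closed K" "invariant \<theta> K" and X: "invariant \<theta> X"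
    and V: "compact V" "X \<subseteq> interior V"
    and iso: "\<And>z. \<lbrakk>z \<in> K; orbit \<theta> z \<subseteq> V\<rbrakk> \<Longrightarrow> z \<in> X"
    and leave: "\<And>W. \<lbrakk>open W; X \<subseteq> W\<rbrakk> \<Longrightarrow> \<exists>x\<in>W \<inter> K. \<exists>s\<ge>0. \<theta> s x \<notin> V"
  shows "\<exists>y. y \<notin> X \<and> alpha_limit \<theta> y \<noteq> {} \<and> alpha_limit \<theta> y \<subseteq> X"
proof -
  \<comment> \<open>A point near \<open>X\<close> that stays in the interior of \<open>V\<close> up to time \<open>n\<close> and
    leaves afterwards exits at a point whose backward orbit has been in \<open>V\<close> for time \<open>n\<close>.\<close>
  have "\<exists>y. y \<in> K \<inter> V - interior V \<and> (\<forall>t\<in>{0..real n}. \<theta> (- t) y \<in> V)" for n :: nat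
  proof -
    obtain W where W: "open W" "X \<subseteq> W" "\<And>x s. x \<in> W \<Longrightarrow> s \<in> {0..real n} \<Longrightarrow> \<theta> s x \<in> interior V"
      using exists_nbhd_staying_until[OF fl X open_interior V(2), of "real n"] by blast
    obtain x s where x: "x \<in> W" "x \<in> K" "s \<ge> 0" "\<theta> s x \<notin> V" using leave[OF W(1,2)] by blast
    have "x \<in> interior V" using W(3)[OF x(1), of 0] flow_zero[OF fl] by simp
    moreover have "\<theta> s x \<notin> interior V" using x(4) interior_subset[of V] by blast
    ultimately obtain \<tau> where \<tau>: "\<tau> \<ge> 0" "\<theta> \<tau> x \<notin> interior V" "\<theta> \<tau> x \<in> closure (interior V)"
      "\<And>t. \<lbrakk>0 \<le> t; t < \<tau>\<rbrakk> \<Longrightarrow> \<theta> t x \<in> interior V"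
      using exit_point[OF fl _ open_interior x(3), of x V] by blast
    have "closure (interior V) \<subseteq> V"
      by (intro closure_minimal interior_subset compact_imp_closed V(1))
    with \<tau>(3) have inV: "\<theta> \<tau> x \<in> V" by blast
    have "\<tau> > real n" using W(3)[OF x(1), of \<tau>] \<tau>(1,2) by force
    have "\<theta> (- t) (\<theta> \<tau> x) \<in> V" if "t \<in> {0..real n}" for t
    proof (cases "t = 0")
      case True
      then show ?thesis using inV flow_zero[OF fl] by simp
    next
      case False
      then have "\<theta> (\<tau> - t) x \<in> interior V" using \<tau>(4)[of "\<tau> - t"] that \<open>\<tau> > real n\<close> by auto
      then show ?thesis using flow_add[OF fl, of "- t" \<tau> x] interior_subset[of V] by auto
    qed
    moreover have "\<theta> \<tau> x \<in> K" using K(2) x(2) by (simp add: invariant_iff[OF fl])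
    ultimately show ?thesis using inV \<tau>(2) by blast
  qed
  then obtain f where f: "\<And>n. f n \<in> K \<inter> V - interior V"
    and backward: "\<And>n t. t \<in> {0..real n} \<Longrightarrow> \<theta> (- t) (f n) \<in> V"
    by metis
  have "compact (K \<inter> V - interior V)"
    using compact_diff[OF closed_Int_compact[OF K(1) V(1)] open_interior] .
  from seq_compactE[OF compact_imp_seq_compact[OF this], of f] f obtain y r
    where y: "y \<in> K \<inter> V - interior V" and r: "strict_mono r" "(f \<circ> r) \<longlonglongrightarrow> y" by blast
  have stay: "\<theta> t y \<in> V" if "t \<le> 0" for t
  proof -
    have "filterlim (\<lambda>n. real (r n)) at_top sequentially"
      by (rule filterlim_compose[OF filterlim_real_sequentially filterlim_subseq[OF r(1)]])
    then have "\<forall>\<^sub>F n in sequentially. - t \<le> real (r n)" by (simp add: filterlim_at_top)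
    then have "\<forall>\<^sub>F n in sequentially. \<theta> t ((f \<circ> r) n) \<in> V"
      by eventually_elim (use backward[of "- t"] that in auto)
    from Lim_in_closed_set[OF compact_imp_closed[OF V(1)] this _ tendsto_flow[OF fl r(2)]]
    show ?thesis by simp
  qed
  have "alpha_limit \<theta> y \<subseteq> K \<inter> V"
    using stay y K by (intro alpha_limit_subset_closed closed_Int compact_imp_closed[OF V(1)])
      (auto simp: invariant_iff[OF fl])
  then have "alpha_limit \<theta> y \<subseteq> X"
    using alpha_limit_flow[OF fl] by (fastforce intro!: iso simp: orbit_def)
  moreover have "alpha_limit \<theta> y \<noteq> {}" by (rule alpha_limit_nonempty[OF V(1)]) (rule stay)
  ultimately show ?thesis using y V(2) by blast
qed

text \<open>The key use of the height condition. Among the orbits in \<open>U\<close> outside \<open>X\<close>, take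
  that of a point \<open>z\<close> with minimal closure \<open>K\<close>. All orbits in \<open>K\<close> outside
  \<open>X\<close> have closure \<open>K\<close>, so none of them fits in a closed neighbourhood \<open>V\<close>
  of \<open>X\<close> that omits \<open>z\<close>: relative to \<open>K\<close>, the set \<open>X\<close> is isolated
  from all other orbits and not just from minimal sets. On the other hand the backward orbit of
  \<open>z\<close> comes arbitrarily close to \<open>X\<close>, the only minimal set available in its limit
  set, and from there the orbit returns to \<open>z\<close>, outside \<open>V\<close>.\<close>
lemma exists_alpha_asymptotic_if_orbit_nearby:
  fixes \<theta> :: "real \<Rightarrow> 'a::metric_space \<Rightarrow> 'a"
  assumes fl: "C0_flow \<theta>" and lc: "locally compact (UNIV :: 'a set)"
    and nh: "\<not> (\<exists>x. infinite_height \<theta> (orbit \<theta> x))"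
    and X: "X \<in> CMin \<theta>" and U: "compact U" "X \<subseteq> interior U"
    and iso: "\<And>Y. \<lbrakk>Y \<in> CMin \<theta>; Y \<subseteq> U\<rbrakk> \<Longrightarrow> Y = X"
    and p: "p \<notin> X" "orbit \<theta> p \<subseteq> U"
  shows "\<exists>y. y \<notin> X \<and> alpha_limit \<theta> y \<noteq> {} \<and> alpha_limit \<theta> y \<subseteq> X"
proof -
  have "closed U" by (rule compact_imp_closed[OF U(1)])
  obtain z where "z \<notin> X \<and> orbit \<theta> z \<subseteq> U"
    and min: "\<forall>w. w \<notin> X \<and> orbit \<theta> w \<subseteq> U \<longrightarrow> closure (orbit \<theta> w) \<subseteq> closure (orbit \<theta> z)
      \<longrightarrow> closure (orbit \<theta> w) = closure (orbit \<theta> z)"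
    by (rule exists_minimal_orbit_closure[where P = "\<lambda>z. z \<notin> X \<and> orbit \<theta> z \<subseteq> U",
          OF nh conjI[OF p]])
  then have z: "z \<notin> X" "orbit \<theta> z \<subseteq> U" by auto
  define K where "K = closure (orbit \<theta> z)"
  have K: "closed K" "invariant \<theta> K"
    unfolding K_def by (rule closed_closure, rule invariant_closure[OF fl invariant_orbit])
  have zK: "z \<in> K"
    unfolding K_def using self_in_orbit[OF fl] closure_subset by (rule rev_subsetD)
  have KU: "K \<subseteq> U" unfolding K_def by (rule closure_minimal[OF z(2) \<open>closed U\<close>])
  have "compact K" using compact_Int_closed[OF U(1) K(1)] KU by (simp add: Int_absorb1)
  have "open (interior U - {z})" "X \<subseteq> interior U - {z}" using U(2) z(1) by auto
  from exists_compact_nbhd[OF lc CMin_D(1)[OF X] this] obtain V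
    where V: "compact V" "X \<subseteq> interior V" "V \<subseteq> interior U - {z}" by blast
  have isoK: "w \<in> X" if "w \<in> K" "orbit \<theta> w \<subseteq> V" for w
  proof (rule ccontr)
    assume "w \<notin> X"
    have sub: "closure (orbit \<theta> w) \<subseteq> V"
      by (intro closure_minimal that compact_imp_closed[OF V(1)])
    then have "z \<notin> closure (orbit \<theta> w)" using V(3) by blast
    moreover have "closure (orbit \<theta> w) \<subseteq> K" by (rule closure_orbit_subset[OF fl K(2,1) that(1)])
    moreover have "orbit \<theta> w \<subseteq> U" using that(2) V(3) interior_subset[of U] by blast
    ultimately show False using min[rule_format, of w] \<open>w \<notin> X\<close> zK unfolding K_def by simp
  qed
  show ?thesis
  proof (rule exists_alpha_asymptotic_if_leaving[OF fl K CMin_D(4)[OF X] V(1,2) isoK])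
    fix W assume W: "open W" "X \<subseteq> W"
    have orbK: "\<theta> t z \<in> K" for t using K(2) zK by (simp add: invariant_iff[OF fl])
    have "alpha_limit \<theta> z \<noteq> {}" and aK: "alpha_limit \<theta> z \<subseteq> K"
      by (rule alpha_limit_nonempty[OF \<open>compact K\<close>], rule orbK,
          rule alpha_limit_subset_closed[OF K(1)], rule orbK)
    then obtain w where w: "w \<in> alpha_limit \<theta> z" by blast
    have cK: "closure (orbit \<theta> w) \<subseteq> K"
      using w aK by (intro closure_orbit_subset[OF fl K(2,1)]) blast
    then have "compact (closure (orbit \<theta> w))"
      using compact_Int_closed[OF \<open>compact K\<close> closed_closure, of "orbit \<theta> w"]
      by (simp add: Int_absorb1)
    from exists_CMin_subset[OF fl nh this _ invariant_closure[OF fl invariant_orbit]]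
    obtain Y where Y: "Y \<in> CMin \<theta>" "Y \<subseteq> closure (orbit \<theta> w)"
      using self_in_orbit[OF fl, of w] by auto
    then have "Y = X" using iso cK KU by blast
    with Y(2) W(2) CMin_D(3)[OF X] have "W \<inter> closure (orbit \<theta> w) \<noteq> {}" by blast
    then have "W \<inter> orbit \<theta> w \<noteq> {}" using open_Int_closure_eq_empty[OF W(1)] by blast
    then obtain s where s: "\<theta> s w \<in> W" by (auto simp: orbit_def)
    from alpha_limit_flow[OF fl w, of s] obtain t
      where t: "filterlim t at_bot sequentially" "(\<lambda>n. \<theta> (t n) z) \<longlonglongrightarrow> \<theta> s w"
      by (auto simp: alpha_limit_def)
    have "\<forall>\<^sub>F n in sequentially. \<theta> (t n) z \<in> W" by (rule topological_tendstoD[OF t(2) W(1) s])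
    moreover have "\<forall>\<^sub>F n in sequentially. t n \<le> 0" using t(1) by (simp add: filterlim_at_bot)
    ultimately have "\<forall>\<^sub>F n in sequentially. \<theta> (t n) z \<in> W \<and> t n \<le> 0" by eventually_elim simp
    then obtain n where n: "\<theta> (t n) z \<in> W" "t n \<le> 0" using eventually_happens by fastforce
    \<comment> \<open>Flowing forward for time \<open>- t n\<close> leads back to \<open>z\<close>.\<close>
    show "\<exists>x\<in>W \<inter> K. \<exists>s\<ge>0. \<theta> s x \<notin> V"
    proof (intro bexI exI conjI)
      show "\<theta> (- t n) (\<theta> (t n) z) \<notin> V" using V(3) by (auto simp: flow_minus_cancel[OF fl])
    qed (use n orbK in auto)
  qed
qed

text \<open>Instability provides the leaving orbits required by the exit argument, with \<open>K\<close> the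
  whole space.\<close>
lemma exists_alpha_asymptotic_if_not_stable:
  fixes \<theta> :: "real \<Rightarrow> 'a::metric_space \<Rightarrow> 'a"
  assumes fl: "C0_flow \<theta>" and lc: "locally compact (UNIV :: 'a set)"
    and X: "compact X" "invariant \<theta> X" and U: "X \<subseteq> interior U"
    and iso: "\<And>z. orbit \<theta> z \<subseteq> U \<Longrightarrow> z \<in> X"
    and "\<not> stable \<theta> X"
  shows "\<exists>y. y \<notin> X \<and> alpha_limit \<theta> y \<noteq> {} \<and> alpha_limit \<theta> y \<subseteq> X"
proof -
  obtain N where N: "X \<subseteq> interior N" "\<And>W. X \<subseteq> interior W \<Longrightarrow> \<not> pos_orbits \<theta> W \<subseteq> N"
    using \<open>\<not> stable \<theta> X\<close> by (auto simp: stable_def nbhd_def)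
  have "open (interior U \<inter> interior N)" "X \<subseteq> interior U \<inter> interior N" using U N(1) by auto
  from exists_compact_nbhd[OF lc X(1) this] obtain V
    where V: "compact V" "X \<subseteq> interior V" "V \<subseteq> interior U \<inter> interior N" by blast
  have "closed (UNIV :: 'a set)" "invariant \<theta> UNIV" by (simp_all add: invariant_iff[OF fl])
  then show ?thesis
  proof (rule exists_alpha_asymptotic_if_leaving[OF fl _ _ X(2) V(1,2)])
    show "z \<in> X" if "orbit \<theta> z \<subseteq> V" for z
      using that V(3) interior_subset[of U] by (intro iso) blast
  next
    fix W assume "open W" "X \<subseteq> W"
    then have "\<not> pos_orbits \<theta> W \<subseteq> N" by (intro N(2)) (simp add: interior_open)
    then show "\<exists>x\<in>W \<inter> UNIV. \<exists>s\<ge>0. \<theta> s x \<notin> V"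
      using V(3) interior_subset[of N] by (fastforce simp: pos_orbits_def)
  qed
qed

text \<open>By stability, positive orbits starting near \<open>X\<close> stay in \<open>U\<close>, and then their
  limit sets consist of entire orbits in \<open>U\<close>.\<close>
lemma stable_isolated_imp_attractor:
  assumes fl: "C0_flow \<theta>" and U: "compact U" "X \<subseteq> interior U"
    and iso: "\<And>z. orbit \<theta> z \<subseteq> U \<Longrightarrow> z \<in> X"
    and "stable \<theta> X"
  shows "attractor \<theta> X"
proof -
  obtain V where V: "X \<subseteq> interior V" "pos_orbits \<theta> V \<subseteq> U"
    using \<open>stable \<theta> X\<close> U(2) by (auto simp: stable_def nbhd_def)
  have "V \<subseteq> pos_basin \<theta> X"
  proof
    fix x assume "x \<in> V"
    then have stay: "\<theta> t x \<in> U" if "t \<ge> 0" for t using V(2) that by (auto simp: pos_orbits_def)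
    have "omega_limit \<theta> x \<subseteq> U"
      by (rule omega_limit_subset_closed[OF compact_imp_closed[OF U(1)]]) (rule stay)
    then have "omega_limit \<theta> x \<subseteq> X"
      using omega_limit_flow[OF fl] by (fastforce intro!: iso simp: orbit_def)
    then show "x \<in> pos_basin \<theta> X"
      using omega_limit_nonempty[of U \<theta> x] U(1) stay by (auto simp: pos_basin_def)
  qed
  then have "nbhd (pos_basin \<theta> X) X" using V(1) interior_mono[of V "pos_basin \<theta> X"]
    by (auto simp: nbhd_def)
  with \<open>stable \<theta> X\<close> show ?thesis by (simp add: attractor_def)
qed

text \<open>Stagnation needs an orbit asymptotic to \<open>X\<close> in each time direction. The exit arguments
  provide one in negative time; applied to the reversed flow they provide the other.\<close>
lemma isolated_from_minimals_imp_AMin: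
  fixes \<theta> :: "real \<Rightarrow> 'a::metric_space \<Rightarrow> 'a"
  assumes fl: "C0_flow \<theta>" and lc: "locally compact (UNIV :: 'a set)"
    and nh: "\<not> (\<exists>x. infinite_height \<theta> (orbit \<theta> x))"
    and X: "X \<in> CMin \<theta>" and "isolated_from_minimals \<theta> X"
  shows "X \<in> AMin \<theta>"
proof -
  have rfl: "C0_flow (reversed \<theta>)" by (rule C0_flow_reversed[OF fl])
  obtain N where N: "X \<subseteq> interior N" "\<And>Y. minimal_set \<theta> Y \<Longrightarrow> \<not> Y \<subseteq> N - X"
    using assms(5) by (auto simp: isolated_from_minimals_def nbhd_def)
  obtain U where U: "compact U" "X \<subseteq> interior U" "U \<subseteq> interior N"
    using exists_compact_nbhd[OF lc CMin_D(1)[OF X] open_interior N(1)] by blast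
  have iso: "Y = X" if Y: "Y \<in> CMin \<theta>" "Y \<subseteq> U" for Y
  proof -
    have "Y \<inter> X \<noteq> {}" using N(2)[OF CMin_D(5)[OF Y(1)]] Y(2) U(3) interior_subset[of N] by blast
    from minimal_sets_disjoint_or_equal[OF fl CMin_D(5)[OF Y(1)] CMin_D(5)[OF X] this]
    show ?thesis .
  qed
  let ?out = "\<lambda>\<theta>. \<exists>y. y \<notin> X \<and> alpha_limit \<theta> y \<noteq> {} \<and> alpha_limit \<theta> y \<subseteq> X"
  have stagnantI: "stagnant \<theta> X" if "?out \<theta>" "?out (reversed \<theta>)"
    using that unfolding stagnant_def alpha_limit_reversed by blast
  have "attractor \<theta> X \<or> repeller \<theta> X \<or> stagnant \<theta> X"
  proof (cases "\<exists>p. p \<notin> X \<and> orbit \<theta> p \<subseteq> U")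
    case True
    then obtain p where p: "p \<notin> X" "orbit \<theta> p \<subseteq> U" by blast
    have "?out \<theta>"
      by (rule exists_alpha_asymptotic_if_orbit_nearby[OF fl lc nh X U(1,2) iso p])
    moreover have "?out (reversed \<theta>)"
      by (rule exists_alpha_asymptotic_if_orbit_nearby[OF rfl lc, of X U p])
        (use nh X U iso p in auto)
    ultimately show ?thesis using stagnantI by blast
  next
    case False
    then have only: "\<And>z. orbit \<theta> z \<subseteq> U \<Longrightarrow> z \<in> X" by blast
    have "?out \<theta>" if "\<not> stable \<theta> X"
      by (rule exists_alpha_asymptotic_if_not_stable[OF fl lc CMin_D(1,4)[OF X] U(2) only that])
    moreover have "?out (reversed \<theta>)" if "\<not> neg_stable \<theta> X"
      by (rule exists_alpha_asymptotic_if_not_stable[OF rfl lc CMin_D(1)[OF X] _ U(2)])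
        (use that only CMin_D(4)[OF X] in auto)
    moreover have "attractor \<theta> X" if "stable \<theta> X"
      by (rule stable_isolated_imp_attractor[OF fl U(1,2) only that])
    moreover have "repeller \<theta> X" if "neg_stable \<theta> X"
      using stable_isolated_imp_attractor[OF rfl U(1,2), of ] only that by simp
    ultimately show ?thesis using stagnantI by blast
  qed
  with X assms(5) show ?thesis by (auto simp: AMin_def)
qed

section \<open>The open and dense set of attractors, repellers and isolated stagnant sets\<close>

theorem corollary5:
  fixes \<theta> :: "real \<Rightarrow> 'a::metric_space \<Rightarrow> 'a"
  assumes "C0_flow \<theta>"
    and "locally compact (UNIV :: 'a set)"
    and "connected (UNIV :: 'a set)"
    and "countable (CMin \<theta>)"
    and "\<not> (\<exists>x. infinite_height \<theta> (orbit \<theta> x))"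
  shows "openin (CMin_topology \<theta>) (AMin \<theta>)
    \<and> CMin_topology \<theta> closure_of (AMin \<theta>) = CMin \<theta>"
proof
  interpret H: Metric_space "CMin \<theta>" hausdorff_dist by (rule Metric_space_CMin)
  show "openin (CMin_topology \<theta>) (AMin \<theta>)"
    unfolding H.openin_mtopology
  proof (intro conjI allI impI)
    show "AMin \<theta> \<subseteq> CMin \<theta>" by (auto simp: AMin_def)
  next
    fix X assume X: "X \<in> AMin \<theta>"
    then have "X \<in> CMin \<theta>" by (simp add: AMin_def)
    then obtain e where e: "e > 0" "\<And>Y. \<lbrakk>Y \<in> CMin \<theta>; hausdorff_dist X Y < e\<rbrakk> \<Longrightarrow> Y = X"
      using isolated_from_minimals_imp_hausdorff_isolated[OF assms(1)]
        AMin_imp_isolated_from_minimals[OF assms(1) X] by blast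
    have "Y \<in> AMin \<theta>" if "Y \<in> H.mball X e" for Y
      using that e(2)[of Y] X by (simp add: H.in_mball)
    with e(1) show "\<exists>r>0. H.mball X r \<subseteq> AMin \<theta>" by (intro exI[of _ e]) auto
  qed
  show "CMin_topology \<theta> closure_of (AMin \<theta>) = CMin \<theta>"
    unfolding H.metric_closure_of
  proof (intro subset_antisym subsetI CollectI conjI allI impI)
    fix X and r :: real assume X: "X \<in> CMin \<theta>" and "r > 0"
    obtain W where W: "open W" "X \<subseteq> W"
      "\<And>Y. \<lbrakk>Y \<in> CMin \<theta>; Y \<subseteq> W\<rbrakk> \<Longrightarrow> hausdorff_dist X Y < r"
      using exists_nbhd_hausdorff_close[OF assms(1) X \<open>r > 0\<close>] by blast
    obtain Y where Y: "Y \<in> CMin \<theta>" "Y \<subseteq> W" "isolated_from_minimals \<theta> Y"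
      using exists_isolated_from_minimals_in_nbhd[OF assms(1,2,4,5) X W(1,2)] by blast
    have "Y \<in> AMin \<theta>" by (rule isolated_from_minimals_imp_AMin[OF assms(1,2,5) Y(1,3)])
    moreover have "Y \<in> H.mball X r" using X Y(1) W(3)[OF Y(1,2)] by (simp add: H.in_mball)
    ultimately show "\<exists>Y\<in>AMin \<theta>. Y \<in> H.mball X r" by blast
  qed auto
qed

end
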